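(* Let $U$ and $O$ be finite sets of users and objects, $E\subseteq U\times O$ with every user incident to at least one edge and every object incident to at least one edge, $w_{ij}\in[0,1]$ for each $(i,j)\in E$, and $\alpha\in(0,1)$. Then the bias of each user converges, under the iterative debiasing algorithm (defined in the context), to a unique value that does not depend on the initial conditions: for every user $i\in U$ there is a real number $b_i^*$ such that, for every initial vector $b^0\in[-1,1]^U$, the sequence $(b_i^t)_{t\ge 0}$ produced by the algorithm from $b^0$ satisfies $\lim_{t\to\infty}b_i^t=b_i^*$.
   Context: For a user $i\in U$ let $d_i^+=\{j\in O:(i,j)\in E\}$ be the set of objects rated by $i$, and for an object $j\in O$ let $d_j^-=\{i\in U:(i,j)\in E\}$ be the set of users rating $j$. The number $w_{ij}$ is the rating given by user $i$ to object $j$. Iterative debiasing algorithm: starting from an initial bias vector $b^0=(b_i^0)_{i\in U}\in[-1,1]^U$, for each integer $t\ge 0$ define $$r_j^{t+1}=\frac{1}{|d_j^-|}\sum_{k\in d_j^-}\max\{0,\min\{1,w_{kj}-\alpha b_k^t\}\}\quad (j\in O),$$ $$b_i^{t+1}=\frac{1}{|d_i^+|}\sum_{j\in d_i^+}\bigl(w_{ij}-r_j^{t+1}\bigr)\quad (i\in U).$$ Here $r_j^t$ is the true rating of object $j$ and $b_i^t$ is the bias of user $i$ after $t$ iterations. *)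

theory Defs
  imports "HOL-Analysis.Analysis"
begin

definition rated_by :: "'o set \<Rightarrow> ('u \<times> 'o) set \<Rightarrow> 'u \<Rightarrow> 'o set" where
  "rated_by Ob E i = {j \<in> Ob. (i, j) \<in> E}"

definition raters_of :: "'u set \<Rightarrow> ('u \<times> 'o) set \<Rightarrow> 'o \<Rightarrow> 'u set" where
  "raters_of U E j = {i \<in> U. (i, j) \<in> E}"

(* The ratings of step t+1 use the biases of step t:
   r_j^(t+1) is true_rating U E w alpha (b^t) j. *)
definition true_rating ::
  "'u set \<Rightarrow> ('u \<times> 'o) set \<Rightarrow> ('u \<Rightarrow> 'o \<Rightarrow> real) \<Rightarrow> real \<Rightarrow> ('u \<Rightarrow> real) \<Rightarrow> 'o \<Rightarrow> real" where
  "true_rating U E w \<alpha> b j =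
     1 / real (card (raters_of U E j)) *
       (\<Sum>k\<in>raters_of U E j. max 0 (min 1 (w k j - \<alpha> * b k)))"

definition user_bias ::
  "'o set \<Rightarrow> ('u \<times> 'o) set \<Rightarrow> ('u \<Rightarrow> 'o \<Rightarrow> real) \<Rightarrow> ('o \<Rightarrow> real) \<Rightarrow> 'u \<Rightarrow> real" where
  "user_bias Ob E w r i =
     1 / real (card (rated_by Ob E i)) * (\<Sum>j\<in>rated_by Ob E i. w i j - r j)"

(* bias_iter U Ob E w alpha b0 t i is b_i^t. Vectors are total functions;
   their values outside U and Ob never enter the sums. *)
primrec bias_iter ::
  "'u set \<Rightarrow> 'o set \<Rightarrow> ('u \<times> 'o) set \<Rightarrow> ('u \<Rightarrow> 'o \<Rightarrow> real) \<Rightarrow> real \<Rightarrow>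
     ('u \<Rightarrow> real) \<Rightarrow> nat \<Rightarrow> 'u \<Rightarrow> real" where
  "bias_iter U Ob E w \<alpha> b0 0 = b0"
| "bias_iter U Ob E w \<alpha> b0 (Suc t) =
     user_bias Ob E w (true_rating U E w \<alpha> (bias_iter U Ob E w \<alpha> b0 t))"

end

theory Submission
  imports Defs
begin

text \<open>
  Clamping to the unit interval and averaging are both nonexpansive for the supremum distance, so one
  round of the algorithm contracts this distance between two bias vectors by the factor \<open>\<alpha>\<close>.
  Hence any two runs approach each other geometrically; comparing the run from \<open>0\<close> with its own
  shift by one step shows that it converges, and all other runs share its limit.
\<close>

text \<open>The triangle inequality bounds the difference of the sums by \<open>card A * D\<close>,
  and the averaging weight cancels \<open>card A\<close>.\<close>

lemma mean_diff_le:
  fixes f g :: "'a \<Rightarrow> real"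
  assumes "D \<ge> 0" and "\<And>x. x \<in> A \<Longrightarrow> \<bar>f x - g x\<bar> \<le> D"
  shows "\<bar>1 / real (card A) * sum f A - 1 / real (card A) * sum g A\<bar> \<le> D"
proof (cases "card A = 0")
  case True
  \<comment> \<open>\<open>A\<close> is empty or infinite: \<open>1 / 0 = 0\<close> makes both means
    0, and the claim becomes \<open>0 \<le> D\<close>.\<close>
  then show ?thesis using assms(1) by simp
next
  case False
  have "\<bar>sum f A - sum g A\<bar> \<le> (\<Sum>x\<in>A. \<bar>f x - g x\<bar>)"
    unfolding sum_subtractf[symmetric] by (rule sum_abs)
  also have "\<dots> \<le> real (card A) * D"
    using assms(2) by (rule sum_bounded_above)
  finally have "\<bar>sum f A - sum g A\<bar> / real (card A) \<le> D"
    using False by (subst pos_divide_le_eq) (simp_all only: of_nat_0_less_iff neq0_conv mult.commute)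
  moreover have "1 / real (card A) * sum f A - 1 / real (card A) * sum g A
      = (sum f A - sum g A) / real (card A)"
    by (simp add: diff_divide_distrib)
  ultimately show ?thesis
    by (simp only: abs_divide abs_of_nat)
qed

lemma clamp_diff_le:
  fixes a b c :: real
  shows "\<bar>max 0 (min 1 (c - a)) - max 0 (min 1 (c - b))\<bar> \<le> \<bar>a - b\<bar>"
  by (auto simp: max_def min_def)

text \<open>The contraction factor arises here: biases enter a rating scaled by
  \<open>\<alpha>\<close>, and neither clamping nor averaging enlarges distances. Control on
  \<open>U\<close> suffices because all raters lie in \<open>U\<close>.\<close>

lemma true_rating_diff_le:
  assumes "\<alpha> \<ge> 0" and "D \<ge> 0" and "\<And>k. k \<in> U \<Longrightarrow> \<bar>x k - y k\<bar> \<le> D"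
  shows "\<bar>true_rating U E w \<alpha> x j - true_rating U E w \<alpha> y j\<bar> \<le> \<alpha> * D"
  unfolding true_rating_def
proof (rule mean_diff_le)
  fix k assume "k \<in> raters_of U E j"
  then have "\<bar>x k - y k\<bar> \<le> D"
    using assms(3) by (simp add: raters_of_def)
  then have "\<bar>\<alpha> * x k - \<alpha> * y k\<bar> \<le> \<alpha> * D"
    using assms(1) by (simp add: abs_mult mult_left_mono flip: right_diff_distrib)
  then show "\<bar>max 0 (min 1 (w k j - \<alpha> * x k)) - max 0 (min 1 (w k j - \<alpha> * y k))\<bar> \<le> \<alpha> * D"
    using clamp_diff_le order_trans by blast
qed (use assms in simp)

lemma user_bias_diff_le:
  assumes "D \<ge> 0" and "\<And>j. \<bar>r j - s j\<bar> \<le> D"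
  shows "\<bar>user_bias Ob E w r i - user_bias Ob E w s i\<bar> \<le> D"
  unfolding user_bias_def
  \<comment> \<open>In the difference of two summands \<open>w i j\<close> cancels, leaving
    \<open>s j - r j\<close> with the order reversed.\<close>
  using assms by (intro mean_diff_le) (simp_all add: abs_minus_commute)

lemma bias_iter_diff_le:
  assumes "\<alpha> \<ge> 0" and "D \<ge> 0" and "\<And>k. k \<in> U \<Longrightarrow> \<bar>x k - y k\<bar> \<le> D" and "i \<in> U"
  shows "\<bar>bias_iter U Ob E w \<alpha> x t i - bias_iter U Ob E w \<alpha> y t i\<bar> \<le> \<alpha> ^ t * D"
  using assms(4)
\<comment> \<open>The next bias of one user depends on the biases of all users who share an object
  with that user, so the induction hypothesis must cover every user.\<close>
proof (induction t arbitrary: i)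
  case 0
  then show ?case using assms(3) by simp
next
  case (Suc t)
  have "\<bar>true_rating U E w \<alpha> (bias_iter U Ob E w \<alpha> x t) j
      - true_rating U E w \<alpha> (bias_iter U Ob E w \<alpha> y t) j\<bar> \<le> \<alpha> * (\<alpha> ^ t * D)" for j
    using assms(1,2) Suc.IH by (intro true_rating_diff_le) simp_all
  then show ?case
    using assms(1,2) by (simp add: user_bias_diff_le mult.assoc)
qed

text \<open>The recursion adds a round at the end; moving it to the start turns a step within one
  run into a comparison of two runs of equal length.\<close>

lemma bias_iter_shift:
  "bias_iter U Ob E w \<alpha> b (Suc t) = bias_iter U Ob E w \<alpha> (bias_iter U Ob E w \<alpha> b 1) t"
proof (induction t)
  case 0
  then show ?case by simp
next
  case (Suc t)
  then show ?case by (metis bias_iter.simps(2))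
qed

lemma bias_iter_merge:
  assumes "finite U" and "0 \<le> \<alpha>" and "i \<in> U"
  shows "\<exists>D. \<forall>t. \<bar>bias_iter U Ob E w \<alpha> x t i - bias_iter U Ob E w \<alpha> y t i\<bar> \<le> \<alpha> ^ t * D"
proof (intro exI allI)
  \<comment> \<open>The sum over the finite set \<open>U\<close> dominates each single distance and
    stands in for the maximum.\<close>
  show "\<bar>bias_iter U Ob E w \<alpha> x t i - bias_iter U Ob E w \<alpha> y t i\<bar>
      \<le> \<alpha> ^ t * (\<Sum>k\<in>U. \<bar>x k - y k\<bar>)" for t
    using assms by (intro bias_iter_diff_le) (auto intro: sum_nonneg member_le_sum)
qed

lemma convergent_if_geometric_steps:
  fixes f :: "nat \<Rightarrow> real"
  assumes "0 \<le> a" and "a < 1" and "\<And>n. \<bar>f (Suc n) - f n\<bar> \<le> a ^ n * D"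
  shows "convergent f"
proof -
  have "summable (\<lambda>n. a ^ n * D)"
    using assms(1,2) by (intro summable_mult2 summable_geometric) simp
  then have "summable (\<lambda>n. f (Suc n) - f n)"
    by (rule summable_comparison_test'[where N = 0]) (use assms(3) in simp)
  \<comment> \<open>The partial sums of the steps telescope.\<close>
  then have "convergent (\<lambda>n. f n - f 0)"
    unfolding summable_iff_convergent sum_lessThan_telescope .
  then show ?thesis
    by (simp add: convergent_diff_const_right_iff)
qed

lemma bias_iter_convergent:
  assumes "finite U" and "0 \<le> \<alpha>" and "\<alpha> < 1" and "i \<in> U"
  shows "convergent (\<lambda>t. bias_iter U Ob E w \<alpha> b t i)"
proof -
  let ?b = "\<lambda>t. bias_iter U Ob E w \<alpha> b t i"
  \<comment> \<open>The first run starts from the biases after one round, so it is \<open>?b\<close>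
    shifted by one.\<close>
  obtain D where "\<And>t. \<bar>bias_iter U Ob E w \<alpha> (bias_iter U Ob E w \<alpha> b 1) t i - ?b t\<bar> \<le> \<alpha> ^ t * D"
    using bias_iter_merge[OF assms(1,2,4),
        where x = "bias_iter U Ob E w \<alpha> b 1" and y = b and Ob = Ob and E = E and w = w]
    by blast
  then have "\<And>t. \<bar>?b (Suc t) - ?b t\<bar> \<le> \<alpha> ^ t * D"
    unfolding bias_iter_shift .
  then show ?thesis
    using assms(2,3) by (intro convergent_if_geometric_steps)
qed

theorem theorem2:
  fixes U :: "'u set" and Ob :: "'o set" and E :: "('u \<times> 'o) set"
    and w :: "'u \<Rightarrow> 'o \<Rightarrow> real" and \<alpha> :: real
  assumes "finite U" and "finite Ob"
    and "E \<subseteq> U \<times> Ob"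
    and "\<forall>i\<in>U. \<exists>j\<in>Ob. (i, j) \<in> E"
    and "\<forall>j\<in>Ob. \<exists>i\<in>U. (i, j) \<in> E"
    and "\<forall>(i, j)\<in>E. w i j \<in> {0..1}"
    and "\<alpha> \<in> {0<..<1}"
  shows "\<forall>i\<in>U. \<exists>bstar::real. \<forall>b0::'u \<Rightarrow> real. (\<forall>k\<in>U. b0 k \<in> {-1..1}) \<longrightarrow>
           (\<lambda>t. bias_iter U Ob E w \<alpha> b0 t i) \<longlonglongrightarrow> bstar"
proof
  fix i assume "i \<in> U"
  with assms have prems: "finite U" "0 \<le> \<alpha>" "\<alpha> < 1" "i \<in> U"
    by simp_all
  \<comment> \<open>The run from 0 serves as reference: \<open>L\<close> is fixed before any
    \<open>b0\<close> is chosen.\<close>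
  obtain L where L: "(\<lambda>t. bias_iter U Ob E w \<alpha> (\<lambda>_. 0) t i) \<longlonglongrightarrow> L"
    using bias_iter_convergent[OF prems] unfolding convergent_def by blast
  have "(\<lambda>t. bias_iter U Ob E w \<alpha> b0 t i) \<longlonglongrightarrow> L" for b0
  proof -
    obtain D where D: "\<And>t. \<bar>bias_iter U Ob E w \<alpha> b0 t i - bias_iter U Ob E w \<alpha> (\<lambda>_. 0) t i\<bar> \<le> \<alpha> ^ t * D"
      using bias_iter_merge[OF prems(1,2,4),
          where x = b0 and y = "\<lambda>_. 0" and Ob = Ob and E = E and w = w]
      by blast
    have "(\<lambda>t. \<alpha> ^ t * D) \<longlonglongrightarrow> 0"
      using prems by (intro tendsto_mult_left_zero LIMSEQ_realpow_zero)
    then have "(\<lambda>t. bias_iter U Ob E w \<alpha> b0 t i - bias_iter U Ob E w \<alpha> (\<lambda>_. 0) t i) \<longlonglongrightarrow> 0"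
      by (rule Lim_null_comparison[rotated]) (use D in simp)
    then show ?thesis
      using L by (rule Lim_transform[rotated])
  qed
  then show "\<exists>bstar::real. \<forall>b0::'u \<Rightarrow> real. (\<forall>k\<in>U. b0 k \<in> {-1..1}) \<longrightarrow>
      (\<lambda>t. bias_iter U Ob E w \<alpha> b0 t i) \<longlonglongrightarrow> bstar"
    by blast
qed

end
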